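(* Let $G:\mathbb{R}^{m+n}\to\mathbb{R}^d$ be a $\mathcal{C}^1$ mapping, let $M:\mathbb{R}^n\rightrightarrows\mathbb{R}^d$ be a multifunction with closed graph, and let $S:\mathbb{R}^m\rightrightarrows\mathbb{R}^n$ be $$S(w)=\{x\in\mathbb{R}^n\mid0\in G(w,x)+M(x)\}.$$ Let $(\bar w,\bar x)\in\operatorname{gph} S$ and suppose that the partial Jacobian $\nabla_wG(w,x)$ has full rank $d$ for all $(w,x)$ around $(\bar w,\bar x)$. Then for every $r\in\mathbb{R}^n$ $$D^*_{\operatorname{dom} S}S(\bar w\mid\bar x)(r)=\limsup_{\substack{(w,x)\to(\bar w,\bar x),\ (w,x)\in\operatorname{gph} S\\ r'\to r}}\ \bigcup_{y\in\mathbb{R}^d}\Big\{\operatorname{proj}_{T_{\operatorname{dom} S}(w)}\big(\nabla_wG(w,x)^*y\big)\ \Big|\ -r'\in\nabla_xG(w,x)^*y+D^*M\big(x\mid-G(w,x)\big)(y)\Big\}.$$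
   Context: For a multifunction $F$: $\operatorname{gph}F=\{(x,u)\mid u\in F(x)\}$, $\operatorname{dom}F=\{x\mid F(x)\neq\emptyset\}$; the restriction $F|_X(x)$ equals $F(x)$ if $x\in X$ and $\emptyset$ otherwise. $A^*$ is the transpose of a matrix $A$. $\limsup$ of sets is the outer limit. For $C\subset\mathbb{R}^n$ and $x\in C$: $T_C(x)$ is the contingent cone ($w$ such that $x+t_kw_k\in C$ for some $t_k\searrow0$, $w_k\to w$); $\widehat N_C(x)$ is the polar of $T_C(x)$; $N_C(x)$ is the limiting normal cone (limits of $v_k\in\widehat N_C(x_k)$, $x_k\to x$ in $C$). All are empty for $x\notin C$. Coderivative: $x^*\in D^*F(\bar x\mid\bar u)(u^* )$ iff $(x^*,-u^* )\in N_{\operatorname{gph}F}(\bar x,\bar u)$. Projections: $\operatorname{proj}_C(x)=\{y\in C\mid\|y-x\|=d(x,C)\}$ (possibly multivalued), $\operatorname{proj}_CZ=\bigcup_{z\in Z}\operatorname{proj}_C(z)$; $\{\operatorname{proj}_C(v)\mid\dots\}$ denotes the union of the sets $\operatorname{proj}_C(v)$ over the indicated $v$. Projectional coderivative of $F:\mathbb{R}^p\rightrightarrows\mathbb{R}^s$ at $\bar x\in X\subseteq\mathbb{R}^p$ for $\bar u\in F(\bar x)$ with respect to $X$: $t^*\in D^*_XF(\bar x\mid\bar u)(u^* )$ iff $$(t^*,-u^* )\in\limsup_{(x,u)\to(\bar x,\bar u),\ (x,u)\in\operatorname{gph}F|_X}\operatorname{proj}_{T_X(x)\times\mathbb{R}^s}N_{\operatorname{gph}F|_X}(x,u).$$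 *)

theory Defs
  imports "HOL-Analysis.Analysis" "HOL-Library.Set_Algebras"
begin

text \<open>A multifunction from \<open>'a\<close> to \<open>'b\<close> is a function \<open>'a \<Rightarrow> 'b set\<close>.\<close>

definition gph :: "('a \<Rightarrow> 'b set) \<Rightarrow> ('a \<times> 'b) set" where
  "gph F = {(x, u). u \<in> F x}"

definition mdom :: "('a \<Rightarrow> 'b set) \<Rightarrow> 'a set" where
  "mdom F = {x. F x \<noteq> {}}"

definition mrestrict :: "('a \<Rightarrow> 'b set) \<Rightarrow> 'a set \<Rightarrow> 'a \<Rightarrow> 'b set" where
  "mrestrict F X x = (if x \<in> X then F x else {})"

text \<open>The set \<open>limsup F(z)\<close> for \<open>z \<rightarrow> z0\<close> within \<open>Z\<close>; as usual in variational analysis,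
  the value \<open>z = z0\<close> itself is allowed along the approximating sequences.\<close>

definition outer_limit ::
    "('a::topological_space \<Rightarrow> 'b::topological_space set) \<Rightarrow> 'a set \<Rightarrow> 'a \<Rightarrow> 'b set" where
  "outer_limit F Z z0 =
     {v. \<exists>z v'. (\<forall>k::nat. z k \<in> Z \<and> v' k \<in> F (z k)) \<and> z \<longlonglongrightarrow> z0 \<and> v' \<longlonglongrightarrow> v}"

text \<open>All cones below are empty at points outside \<open>C\<close>.\<close>

definition contingent_cone :: "'a::real_normed_vector set \<Rightarrow> 'a \<Rightarrow> 'a set" where
  "contingent_cone C x =
     {w. x \<in> C \<and> (\<exists>(t::nat \<Rightarrow> real) w'. (\<forall>k. 0 < t k) \<and> t \<longlonglongrightarrow> 0 \<and> w' \<longlonglongrightarrow> w \<and>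
                     (\<forall>k. x + t k *\<^sub>R w' k \<in> C))}"

definition polar_cone :: "'a::real_inner set \<Rightarrow> 'a set" where
  "polar_cone K = {v. \<forall>w\<in>K. v \<bullet> w \<le> 0}"

definition regular_normal_cone :: "'a::real_inner set \<Rightarrow> 'a \<Rightarrow> 'a set" where
  "regular_normal_cone C x = (if x \<in> C then polar_cone (contingent_cone C x) else {})"

definition limiting_normal_cone :: "'a::real_inner set \<Rightarrow> 'a \<Rightarrow> 'a set" where
  "limiting_normal_cone C x =
     (if x \<in> C then outer_limit (regular_normal_cone C) C x else {})"

definition coderivative ::
    "('a::real_inner \<Rightarrow> 'b::real_inner set) \<Rightarrow> 'a \<Rightarrow> 'b \<Rightarrow> 'b \<Rightarrow> 'a set" where
  "coderivative F x u u' = {x'. (x', - u') \<in> limiting_normal_cone (gph F) (x, u)}"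

definition proj :: "'a::metric_space set \<Rightarrow> 'a \<Rightarrow> 'a set" where
  "proj C x = {y \<in> C. dist y x = infdist x C}"

definition proj_set :: "'a::metric_space set \<Rightarrow> 'a set \<Rightarrow> 'a set" where
  "proj_set C Z = (\<Union>z\<in>Z. proj C z)"

text \<open>The product types carry the Euclidean inner product, hence the Euclidean norm.\<close>

definition projectional_coderivative ::
    "('a::real_inner) set \<Rightarrow> ('a \<Rightarrow> 'b::real_inner set) \<Rightarrow> 'a \<Rightarrow> 'b \<Rightarrow> 'b \<Rightarrow> 'a set" where
  "projectional_coderivative X F x0 u0 u' =
     {t'. (t', - u') \<in>
        outer_limit
          (\<lambda>(x, u). proj_set (contingent_cone X x \<times> UNIV)
                             (limiting_normal_cone (gph (mrestrict F X)) (x, u)))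
          (gph (mrestrict F X)) (x0, u0)}"

definition continuously_differentiable ::
    "('a::real_normed_vector \<Rightarrow> 'b::real_normed_vector) \<Rightarrow> bool" where
  "continuously_differentiable f \<longleftrightarrow>
     (\<exists>f'. (\<forall>x. (f has_derivative blinfun_apply (f' x)) (at x)) \<and> continuous_on UNIV f')"

definition jacobian_w ::
    "((real^'m) \<times> (real^'n) \<Rightarrow> real^'d) \<Rightarrow> real^'m \<Rightarrow> real^'n \<Rightarrow> real^'m^'d" where
  "jacobian_w G w x = jacobian (\<lambda>w'. G (w', x)) (at w)"

definition jacobian_x ::
    "((real^'m) \<times> (real^'n) \<Rightarrow> real^'d) \<Rightarrow> real^'m \<Rightarrow> real^'n \<Rightarrow> real^'n^'d" where
  "jacobian_x G w x = jacobian (\<lambda>x'. G (w, x')) (at x)"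

end

theory Submission
  imports Defs
begin

text \<open>The graph of \<open>S\<close> is the preimage of the graph of \<open>M\<close> under \<open>F (w, x) = (x, - G (w, x))\<close>, and
  the full rank of \<open>\<nabla>\<^sub>w G\<close> makes \<open>F\<close> a submersion near the reference point. For a submersion the
  limiting normal cone of a preimage is exactly the image of the limiting normal cone under the
  adjoint derivative, which expresses the normals to the graph of \<open>S\<close> through \<open>D\<^sup>* M\<close>. Projecting
  onto \<open>T \<times> \<real>\<^sup>n\<close> acts on the first component only, so both outer limits run over the same
  sequences.\<close>

section \<open>Outer limits and projections\<close>

text \<open>Dropping finitely many terms changes no limit, so constructions valid only near
  \<open>z0\<close> suffice.\<close>

lemma outer_limitI_eventually:
  assumes ev: "\<forall>\<^sub>F k in sequentially. z k \<in> Z \<and> v' k \<in> \<Phi> (z k)"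
    and "z \<longlonglongrightarrow> z0" "v' \<longlonglongrightarrow> v"
  shows "v \<in> outer_limit \<Phi> Z z0"
proof -
  obtain N where N: "\<And>k. k \<ge> N \<Longrightarrow> z k \<in> Z \<and> v' k \<in> \<Phi> (z k)"
    using ev by (auto simp: eventually_sequentially)
  have "(\<forall>k. z (k + N) \<in> Z \<and> v' (k + N) \<in> \<Phi> (z (k + N))) \<and>
      (\<lambda>k. z (k + N)) \<longlonglongrightarrow> z0 \<and> (\<lambda>k. v' (k + N)) \<longlonglongrightarrow> v"
    using N assms(2,3) by (auto intro: LIMSEQ_ignore_initial_segment)
  then show ?thesis
    unfolding outer_limit_def by (intro CollectI exI)
qed

lemma outer_limit_mono_eventually:
  assumes "\<forall>\<^sub>F z in nhds z0. z \<in> Z \<longrightarrow> \<Phi> z \<subseteq> \<Psi> z"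
  shows "outer_limit \<Phi> Z z0 \<subseteq> outer_limit \<Psi> Z z0"
proof
  fix v assume "v \<in> outer_limit \<Phi> Z z0"
  then obtain z v' where z: "\<And>k. z k \<in> Z \<and> v' k \<in> \<Phi> (z k)" "z \<longlonglongrightarrow> z0" "v' \<longlonglongrightarrow> v"
    unfolding outer_limit_def by blast
  have "\<forall>\<^sub>F k in sequentially. z k \<in> Z \<longrightarrow> \<Phi> (z k) \<subseteq> \<Psi> (z k)"
    using assms z(2) by (rule eventually_compose_filterlim)
  then have "\<forall>\<^sub>F k in sequentially. z k \<in> Z \<and> v' k \<in> \<Psi> (z k)"
    by eventually_elim (use z(1) in blast)
  then show "v \<in> outer_limit \<Psi> Z z0"
    using z(2,3) by (rule outer_limitI_eventually)
qed

lemma outer_limit_cong_eventually: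
  assumes "\<forall>\<^sub>F z in nhds z0. z \<in> Z \<longrightarrow> \<Phi> z = \<Psi> z"
  shows "outer_limit \<Phi> Z z0 = outer_limit \<Psi> Z z0"
  by (intro antisym outer_limit_mono_eventually) (use assms in \<open>auto elim: eventually_mono\<close>)

text \<open>The projectional coderivative fixes \<open>- r\<close> in the limit, whereas the formula
  to be proved lets \<open>r'\<close> tend to \<open>r\<close>. Since convergence in a product is
  componentwise, the second component of the values can be moved, with its sign changed, into the
  base variable.\<close>

lemma outer_limit_slice:
  fixes \<Phi> :: "'a::topological_space \<Rightarrow> ('b::topological_space \<times> 'c::real_normed_vector) set"
  shows "{t. (t, - r) \<in> outer_limit \<Phi> Z z0} =
    outer_limit (\<lambda>(z, r'). {t. (t, - r') \<in> \<Phi> z}) (Z \<times> UNIV) (z0, r)" (is "?L = ?R")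
proof (intro equalityI subsetI)
  fix t assume "t \<in> ?L"
  then obtain z v where z: "\<And>k. z k \<in> Z \<and> v k \<in> \<Phi> (z k)" "z \<longlonglongrightarrow> z0" "v \<longlonglongrightarrow> (t, - r)"
    unfolding outer_limit_def by blast
  show "t \<in> ?R"
  proof (rule outer_limitI_eventually)
    show "\<forall>\<^sub>F k in sequentially. (z k, - snd (v k)) \<in> Z \<times> UNIV \<and>
        fst (v k) \<in> (case (z k, - snd (v k)) of (z, r') \<Rightarrow> {t. (t, - r') \<in> \<Phi> z})"
      using z(1) by simp
    show "(\<lambda>k. (z k, - snd (v k))) \<longlonglongrightarrow> (z0, r)" "(\<lambda>k. fst (v k)) \<longlonglongrightarrow> t"
      using tendsto_Pair[OF z(2) tendsto_minus[OF tendsto_snd[OF z(3)]]] tendsto_fst[OF z(3)]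
      by simp_all
  qed
next
  fix t assume "t \<in> ?R"
  then obtain z t' where z: "\<And>k. fst (z k) \<in> Z \<and> (t' k, - snd (z k)) \<in> \<Phi> (fst (z k))"
    "z \<longlonglongrightarrow> (z0, r)" "t' \<longlonglongrightarrow> t"
    unfolding outer_limit_def by (simp add: case_prod_beta mem_Times_iff) blast
  have "(t, - r) \<in> outer_limit \<Phi> Z z0"
  proof (rule outer_limitI_eventually)
    show "\<forall>\<^sub>F k in sequentially. fst (z k) \<in> Z \<and> (t' k, - snd (z k)) \<in> \<Phi> (fst (z k))"
      using z(1) by simp
    show "(\<lambda>k. fst (z k)) \<longlonglongrightarrow> z0" "(\<lambda>k. (t' k, - snd (z k))) \<longlonglongrightarrow> (t, - r)"
      using tendsto_fst[OF z(2)] tendsto_Pair[OF z(3) tendsto_minus[OF tendsto_snd[OF z(2)]]]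
      by simp_all
  qed
  then show "t \<in> ?L" ..
qed

section \<open>Projections onto cylinders\<close>

lemma infdist_Times_UNIV:
  assumes "C \<noteq> {}"
  shows "infdist (v, s) (C \<times> UNIV) = infdist v C"
proof (rule antisym)
  show "infdist (v, s) (C \<times> UNIV) \<le> infdist v C"
    unfolding infdist_notempty[OF assms]
  proof (rule cINF_greatest[OF assms])
    fix c assume "c \<in> C"
    then show "infdist (v, s) (C \<times> UNIV) \<le> dist v c"
      by (intro infdist_le2[of "(c, s)"]) (auto simp: dist_Pair_Pair)
  qed
  have ne: "C \<times> UNIV \<noteq> {}"
    using assms by auto
  show "infdist v C \<le> infdist (v, s) (C \<times> UNIV)"
    unfolding infdist_notempty[OF ne]
  proof (rule cINF_greatest[OF ne])
    fix p assume "p \<in> C \<times> (UNIV :: 'b set)"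
    then show "infdist v C \<le> dist (v, s) p"
      by (intro infdist_le2[of "fst p"]) (auto simp: dist_Pair_Pair real_le_rsqrt)
  qed
qed

text \<open>By Pythagoras: a point of the cylinder at distance \<open>infdist v C\<close> from
  \<open>(v, s)\<close> already spends all of it in the first component, so its second component
  must be \<open>s\<close>.\<close>

lemma proj_Times_UNIV: "proj (C \<times> UNIV) (v, s) = proj C v \<times> {s}"
proof (cases "C = {}")
  case False
  have "s' = s \<and> dist y v = infdist v C"
    if "y \<in> C" and eq: "dist (y, s') (v, s) = infdist v C" for y s'
  proof -
    have "dist (y, s') (v, s) \<le> dist y v"
      using infdist_le[OF \<open>y \<in> C\<close>, of v] eq by (simp add: dist_commute)
    then have "(dist y v)\<^sup>2 + (dist s' s)\<^sup>2 \<le> (dist y v)\<^sup>2"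
      by (simp add: dist_Pair_Pair real_sqrt_le_iff' sqrt_le_D)
    then have "s' = s"
      by simp
    then show ?thesis
      using eq by (simp add: dist_Pair_Pair)
  qed
  moreover have "dist (y, s) (v, s) = dist y v" for y
    by (simp add: dist_Pair_Pair)
  ultimately show ?thesis
    unfolding proj_def infdist_Times_UNIV[OF False] by auto
qed (simp add: proj_def)

section \<open>Normal cones of preimages under submersions\<close>

lemma contingent_coneI_eventually:
  assumes "x \<in> C" and ev: "\<forall>\<^sub>F k in sequentially. 0 < t k \<and> x + t k *\<^sub>R w' k \<in> C"
    and "t \<longlonglongrightarrow> 0" "w' \<longlonglongrightarrow> w"
  shows "w \<in> contingent_cone C x"
proof -
  obtain N where N: "\<And>k. k \<ge> N \<Longrightarrow> 0 < t k \<and> x + t k *\<^sub>R w' k \<in> C"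
    using ev by (auto simp: eventually_sequentially)
  have "(\<forall>k. 0 < t (k + N)) \<and> (\<lambda>k. t (k + N)) \<longlonglongrightarrow> 0 \<and> (\<lambda>k. w' (k + N)) \<longlonglongrightarrow> w \<and>
      (\<forall>k. x + t (k + N) *\<^sub>R w' (k + N) \<in> C)"
    using N assms(3,4) by (auto intro: LIMSEQ_ignore_initial_segment)
  then show ?thesis
    unfolding contingent_cone_def using \<open>x \<in> C\<close>
    by (intro CollectI conjI exI[of _ "\<lambda>k. t (k + N)"] exI[of _ "\<lambda>k. w' (k + N)"]) auto
qed

lemma zero_in_contingent_cone: "x \<in> C \<Longrightarrow> 0 \<in> contingent_cone C x"
  by (rule contingent_coneI_eventually[of _ _ "\<lambda>k. inverse (real (Suc k))" "\<lambda>_. 0"])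
    (auto intro: LIMSEQ_inverse_real_of_nat simp del: of_nat_Suc)

text \<open>The Frechet remainder is uniform in the direction, so the directions \<open>w' k\<close>
  may vary along the sequence (Hadamard differentiability).\<close>

lemma has_derivative_directional_limit:
  assumes der: "(f has_derivative f') (at x)"
    and t: "\<And>k::nat. 0 < t k" "t \<longlonglongrightarrow> 0" and w: "w' \<longlonglongrightarrow> w"
  shows "(\<lambda>k. (f (x + t k *\<^sub>R w' k) - f x) /\<^sub>R t k) \<longlonglongrightarrow> f' w"
proof -
  interpret f': bounded_linear f'
    using der by (rule has_derivative_bounded_linear)
  define q where "q h = (f (x + h) - f x - f' h) /\<^sub>R norm h" for h
  \<comment> \<open>\<open>q 0 = 0\<close> by the convention for division by zero, so \<open>q\<close> is continuous at \<open>0\<close> and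
    zero increments need no separate treatment.\<close>
  have "(q \<longlongrightarrow> q 0) (at 0)"
    using der unfolding has_derivative_at q_def
    by (simp add: f'.zero, subst tendsto_norm_zero_iff[symmetric]) (simp add: divide_inverse_commute)
  then have "(q \<longlongrightarrow> q 0) (nhds 0)"
    by (simp add: tendsto_at_iff_tendsto_nhds)
  moreover have "(\<lambda>k. t k *\<^sub>R w' k) \<longlonglongrightarrow> 0"
    using tendsto_scaleR[OF t(2) w] by simp
  ultimately have "(\<lambda>k. q (t k *\<^sub>R w' k)) \<longlonglongrightarrow> q 0"
    by (rule filterlim_compose)
  then have "(\<lambda>k. f' (w' k) + norm (w' k) *\<^sub>R q (t k *\<^sub>R w' k)) \<longlonglongrightarrow> f' w + norm w *\<^sub>R q 0"
    by (intro tendsto_intros f'.tendsto w)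
  \<comment> \<open>This is \<open>f (x + h) - f x = f' h + norm h *\<^sub>R q h\<close> for
    \<open>h = t k *\<^sub>R w' k\<close>, divided by \<open>t k\<close>.\<close>
  moreover have "f' (w' k) + norm (w' k) *\<^sub>R q (t k *\<^sub>R w' k) =
      (f (x + t k *\<^sub>R w' k) - f x) /\<^sub>R t k" for k
    using t(1)[of k]
    by (cases "w' k = 0") (auto simp: q_def f'.scaleR f'.zero algebra_simps)
  ultimately show ?thesis
    by (simp add: q_def f'.zero)
qed

text \<open>With a right inverse \<open>R\<close> of \<open>A = F' z0\<close>, the map \<open>\<Phi> z = z + R (F z - A z)\<close> is a local
  diffeomorphism with \<open>\<Phi>' z0 = id\<close> and \<open>A \<circ> \<Phi> = F\<close>; the section is its inverse, recentred.\<close>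

lemma submersion_local_section:
  fixes F :: "'a::euclidean_space \<Rightarrow> 'b::euclidean_space"
  assumes derF: "\<And>z. (F has_derivative blinfun_apply (F' z)) (at z)"
    and contF: "continuous_on UNIV F'"
    and surj: "surj (blinfun_apply (F' z0))"
  obtains g where "g 0 = z0" "(g has_derivative (\<lambda>h. h)) (at 0)"
    "\<forall>\<^sub>F p in nhds 0. F (g p) = F z0 + F' z0 p"
proof -
  define A where "A = F' z0"
  have "linear (blinfun_apply A)"
    by (simp add: blinfun.bounded_linear_right bounded_linear.linear)
  then obtain R0 where R0: "linear R0" "blinfun_apply A \<circ> R0 = id"
    using linear_surjective_right_inverse surj A_def by blast
  define R where "R = Blinfun R0"
  have R [simp]: "A (R y) = y" for y
    using R0 unfolding R_def
    by (simp add: bounded_linear_Blinfun_apply linear_conv_bounded_linear fun_eq_iff)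
  define \<Phi> where "\<Phi> z = z + R (F z - A z)" for z
  define \<Phi>' where "\<Phi>' z = id_blinfun + (R o\<^sub>L (F' z - A))" for z
  have A\<Phi>: "A (\<Phi> z) = F z" for z
    by (simp add: \<Phi>_def blinfun.bilinear_simps)
  have der\<Phi>: "(\<Phi> has_derivative blinfun_apply (\<Phi>' z)) (at z)" for z
    unfolding \<Phi>_def[abs_def]
    by (rule has_derivative_eq_rhs, (rule derivative_intros derF)+)
      (auto simp: \<Phi>'_def blinfun.bilinear_simps)
  have cont: "continuous_on UNIV \<Phi>'"
    unfolding \<Phi>'_def by (intro continuous_intros contF)
  have \<Phi>'z0: "\<Phi>' z0 = id_blinfun"
    by (simp add: \<Phi>'_def A_def)
  have inv: "id_blinfun o\<^sub>L \<Phi>' z0 = id_blinfun"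
    by (rule blinfun_eqI) (simp add: \<Phi>'z0)
  obtain U V g g' where hom: "z0 \<in> U" "open V" "\<Phi> z0 \<in> V" "homeomorphism U V \<Phi> g"
    and der: "\<And>y. y \<in> V \<Longrightarrow> (g has_derivative (g' y)) (at y)"
      "\<And>y. y \<in> V \<Longrightarrow> g' y = inv (blinfun_apply (\<Phi>' (g y)))"
    by (rule inverse_function_theorem[OF open_UNIV der\<Phi> cont UNIV_I inv]) blast
  have gz0: "g (\<Phi> z0) = z0"
    using hom by (simp add: homeomorphism_def)
  show ?thesis
  proof
    show "g (\<Phi> z0 + 0) = z0"
      by (simp add: gz0)
    have "g' (\<Phi> z0) = (\<lambda>h. h)"
      using der(2)[OF hom(3)] by (simp add: gz0 \<Phi>'z0 inv_id[unfolded id_def] id_def)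
    then have "(g has_derivative (\<lambda>h. h)) (at (\<Phi> z0 + 0))"
      using der(1)[OF hom(3)] by simp
    moreover have "((+) (\<Phi> z0) has_derivative (\<lambda>h. h)) (at 0)"
      by (auto intro!: derivative_eq_intros)
    ultimately show "((\<lambda>p. g (\<Phi> z0 + p)) has_derivative (\<lambda>h. h)) (at 0)"
      using has_derivative_compose[where f = "(+) (\<Phi> z0)" and f' = "\<lambda>h. h"] by blast
    have "((\<lambda>p. \<Phi> z0 + p) \<longlongrightarrow> \<Phi> z0 + 0) (nhds 0)"
      by (intro tendsto_intros filterlim_ident)
    then have "\<forall>\<^sub>F p in nhds 0. \<Phi> z0 + p \<in> V"
      using hom(2,3) by (intro topological_tendstoD) auto
    then show "\<forall>\<^sub>F p in nhds 0. F (g (\<Phi> z0 + p)) = F z0 + F' z0 p"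
    proof eventually_elim
      case (elim p)
      \<comment> \<open>Applying \<open>A\<close> to this identity gives the claim, because
        \<open>A \<circ> \<Phi> = F\<close> and \<open>A\<close> is additive.\<close>
      then have "\<Phi> (g (\<Phi> z0 + p)) = \<Phi> z0 + p"
        using hom(4) by (simp add: homeomorphism_def)
      then show ?case
        using A\<Phi>[of "g (\<Phi> z0 + p)"] A\<Phi>[of z0] by (simp add: blinfun.add_right A_def)
    qed
  qed
qed

text \<open>Difference quotients of \<open>F\<close> send tangent sequences of the preimage to
  tangent sequences of \<open>D\<close>. Conversely, the local section \<open>g\<close>, which makes
  \<open>F \<circ> g\<close> affine near 0, lifts tangent sequences of \<open>D\<close>
  back.\<close>

lemma contingent_cone_vimage:
  fixes F :: "'a::euclidean_space \<Rightarrow> 'b::euclidean_space"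
  assumes derF: "\<And>z. (F has_derivative blinfun_apply (F' z)) (at z)"
    and contF: "continuous_on UNIV F'"
    and surj: "surj (blinfun_apply (F' z0))"
  shows "contingent_cone (F -` D) z0 = F' z0 -` contingent_cone D (F z0)"
proof (intro equalityI subsetI)
  fix h assume "h \<in> contingent_cone (F -` D) z0"
  then obtain t h' where h: "F z0 \<in> D" "\<And>k::nat. 0 < t k" "t \<longlonglongrightarrow> 0" "h' \<longlonglongrightarrow> h"
    "\<And>k. F (z0 + t k *\<^sub>R h' k) \<in> D"
    unfolding contingent_cone_def by auto
  have "\<forall>k. 0 < t k \<and> F z0 + t k *\<^sub>R ((F (z0 + t k *\<^sub>R h' k) - F z0) /\<^sub>R t k) \<in> D"
    using h(2,5) by (simp add: less_imp_neq[symmetric])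
  then show "h \<in> F' z0 -` contingent_cone D (F z0)"
    using contingent_coneI_eventually[OF h(1) _ h(3)
        has_derivative_directional_limit[OF derF h(2,3,4)]] by auto
next
  fix h assume "h \<in> F' z0 -` contingent_cone D (F z0)"
  then obtain t k' where k: "F z0 \<in> D" "\<And>k::nat. 0 < t k" "t \<longlonglongrightarrow> 0" "k' \<longlonglongrightarrow> F' z0 h"
    "\<And>k. F z0 + t k *\<^sub>R k' k \<in> D"
    unfolding contingent_cone_def by auto
  have lin: "linear (blinfun_apply (F' z0))"
    by (simp add: blinfun.bounded_linear_right bounded_linear.linear)
  then obtain R where R: "linear R" "blinfun_apply (F' z0) \<circ> R = id"
    using linear_surjective_right_inverse surj by blast
  obtain g where g: "g 0 = z0" "(g has_derivative (\<lambda>h. h)) (at 0)"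
    "\<forall>\<^sub>F p in nhds 0. F (g p) = F z0 + F' z0 p"
    using submersion_local_section[OF derF contF surj] by blast
  \<comment> \<open>The right inverse corrects \<open>h\<close> so that \<open>F' z0\<close> maps
    \<open>p k\<close> exactly to \<open>k' k\<close>, while \<open>p k\<close> still tends to
    \<open>h\<close>.\<close>
  define p where "p k = h + R (k' k - F' z0 h)" for k
  have Ap: "F' z0 (p k) = k' k" for k
    using R(2) by (simp add: p_def blinfun.bilinear_simps fun_eq_iff)
  have "(\<lambda>k. h + R (k' k - F' z0 h)) \<longlonglongrightarrow> h + R (F' z0 h - F' z0 h)"
    using R(1) by (intro tendsto_intros k(4) bounded_linear.tendsto[of R])
      (simp add: linear_conv_bounded_linear)
  then have p: "p \<longlonglongrightarrow> h"
    using R(1) by (simp add: p_def[abs_def] linear_0)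
  have "(\<lambda>k. t k *\<^sub>R p k) \<longlonglongrightarrow> 0"
    using tendsto_scaleR[OF k(3) p] by simp
  with g(3) have "\<forall>\<^sub>F k in sequentially. F (g (t k *\<^sub>R p k)) = F z0 + F' z0 (t k *\<^sub>R p k)"
    by (rule eventually_compose_filterlim)
  \<comment> \<open>These points are \<open>g (t k *\<^sub>R p k)\<close>, and \<open>F\<close> maps
    them to \<open>F z0 + t k *\<^sub>R k' k\<close>, which lies in \<open>D\<close>.\<close>
  then have "\<forall>\<^sub>F k in sequentially. 0 < t k \<and>
      z0 + t k *\<^sub>R ((g (t k *\<^sub>R p k) - z0) /\<^sub>R t k) \<in> F -` D"
  proof eventually_elim
    case (elim k)
    then show ?case
      using k(2)[of k] k(5)[of k] by (simp add: blinfun.scaleR_right Ap)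
  qed
  moreover have "(\<lambda>k. (g (t k *\<^sub>R p k) - z0) /\<^sub>R t k) \<longlonglongrightarrow> h"
    using has_derivative_directional_limit[OF g(2) k(2,3) p] by (simp add: g(1))
  ultimately show "h \<in> contingent_cone (F -` D) z0"
    using k(1,3) by (intro contingent_coneI_eventually) auto
qed

section \<open>Polars and regular normals of preimages\<close>

text \<open>Since \<open>0 \<in> K\<close>, the preimage contains the kernel of \<open>A\<close>, a
  subspace; a polar vector is therefore orthogonal to the kernel and so lies in the range of the
  adjoint.\<close>

lemma polar_cone_vimage:
  fixes A :: "'a::euclidean_space \<Rightarrow> 'b::euclidean_space"
  assumes A: "linear A" "surj A" and K: "0 \<in> K"
  shows "polar_cone (A -` K) = adjoint A ` polar_cone K"
proof (intro equalityI subsetI)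
  fix v assume "v \<in> polar_cone (A -` K)"
  then have v: "\<And>h. A h \<in> K \<Longrightarrow> v \<bullet> h \<le> 0"
    by (auto simp: polar_cone_def)
  obtain R where R: "linear R" "A \<circ> R = id"
    using linear_surjective_right_inverse A by blast
  have AR: "A (R y) = y" for y
    using R(2) by (simp add: fun_eq_iff)
  have "h \<bullet> v = h \<bullet> adjoint A (adjoint R v)" for h
  proof -
    \<comment> \<open>Both signs lie in the kernel of \<open>A\<close>, hence in the preimage of
      \<open>K\<close>, so the polar inequality becomes an equality.\<close>
    have "A (h - R (A h)) = 0" "A (R (A h) - h) = 0"
      by (simp_all add: linear_diff[OF A(1)] AR)
    then have "v \<bullet> (h - R (A h)) = 0"
      using v[of "h - R (A h)"] v[of "R (A h) - h"] K by (simp add: inner_diff_right)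
    then show ?thesis
      by (simp add: adjoint_works A R inner_diff_right inner_commute)
  qed
  then have "v = adjoint A (adjoint R v)"
    by (metis vector_eq_rdot inner_commute)
  \<comment> \<open>For \<open>y \<in> K\<close> the vector \<open>R y\<close> lies in the preimage,
    so \<open>v\<close> can be tested against it.\<close>
  moreover have "adjoint R v \<in> polar_cone K"
    using v AR
    by (simp add: polar_cone_def adjoint_works R inner_commute[of "adjoint R v"] inner_commute[of v])
  ultimately show "v \<in> adjoint A ` polar_cone K"
    by blast
next
  fix v assume "v \<in> adjoint A ` polar_cone K"
  then show "v \<in> polar_cone (A -` K)"
    by (auto simp: polar_cone_def inner_commute adjoint_works A)
qed

lemma regular_normal_cone_vimage:
  fixes F :: "'a::euclidean_space \<Rightarrow> 'b::euclidean_space"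
  assumes "\<And>z. (F has_derivative blinfun_apply (F' z)) (at z)"
    and "continuous_on UNIV F'"
    and "surj (blinfun_apply (F' z0))"
  shows "regular_normal_cone (F -` D) z0 = adjoint (F' z0) ` regular_normal_cone D (F z0)"
  unfolding regular_normal_cone_def contingent_cone_vimage[OF assms]
  by (auto simp: polar_cone_vimage zero_in_contingent_cone assms(3)
      blinfun.bounded_linear_right bounded_linear.linear)

section \<open>Limiting normals of preimages\<close>

lemma adjoint_blinfun_tendsto:
  fixes A :: "nat \<Rightarrow> 'a::euclidean_space \<Rightarrow>\<^sub>L 'b::euclidean_space"
  assumes "A \<longlonglongrightarrow> B" "u \<longlonglongrightarrow> l"
  shows "(\<lambda>k. adjoint (A k) (u k)) \<longlonglongrightarrow> adjoint B l"
proof (rule tendsto_componentwise_iff[THEN iffD2], rule ballI)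
  fix b :: 'a assume "b \<in> Basis"
  have lin: "linear (blinfun_apply C)" for C :: "'a \<Rightarrow>\<^sub>L 'b"
    by (simp add: blinfun.bounded_linear_right bounded_linear.linear)
  have "(\<lambda>k. A k b \<bullet> u k) \<longlonglongrightarrow> B b \<bullet> l"
    by (intro tendsto_intros assms)
  then show "(\<lambda>k. adjoint (A k) (u k) \<bullet> b) \<longlonglongrightarrow> adjoint B l \<bullet> b"
    by (simp add: inner_commute[of _ b] adjoint_works[OF lin])
qed

text \<open>Near a surjective limit the adjoints are uniformly bounded below, so bounded images come
  from bounded multipliers; this is the compactness behind the formula for limiting normals.\<close>

lemma bounded_adjoint_preimages:
  fixes A :: "nat \<Rightarrow> 'a::euclidean_space \<Rightarrow>\<^sub>L 'b::euclidean_space"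
  assumes A: "A \<longlonglongrightarrow> B" and surj: "surj (blinfun_apply B)"
    and bd: "bounded (range (\<lambda>k. adjoint (A k) (u k)))"
  shows "bounded (range u)"
proof -
  have lin: "linear (blinfun_apply C)" for C :: "'a \<Rightarrow>\<^sub>L 'b"
    by (simp add: blinfun.bounded_linear_right bounded_linear.linear)
  then obtain R0 where R0: "linear R0" "blinfun_apply B \<circ> R0 = id"
    using linear_surjective_right_inverse surj by blast
  define R where "R = Blinfun R0"
  have BR: "B (R y) = y" for y
    using R0 unfolding R_def
    by (simp add: bounded_linear_Blinfun_apply linear_conv_bounded_linear fun_eq_iff)
  obtain c where "0 < c" and c: "\<And>k. norm (adjoint (A k) (u k)) \<le> c"
    using bd by (auto simp: bounded_pos)
  have "(\<lambda>k. norm (B - A k) * norm R) \<longlonglongrightarrow> norm (B - B) * norm R"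
    by (intro tendsto_intros A)
  \<comment> \<open>After division by \<open>norm (u k)\<close>, replacing \<open>B\<close> by
    \<open>A k\<close> costs at most \<open>norm (B - A k) * norm R * norm (u k)\<close>. Below
    \<open>1 / 2\<close> this is absorbed by the left side, at the price of the factor 2.\<close>
  then have "\<forall>\<^sub>F k in sequentially. norm (B - A k) * norm R < 1 / 2"
    by (intro order_tendstoD(2)) auto
  then have "\<forall>\<^sub>F k in sequentially. norm (u k) \<le> 2 * (c * norm R)"
  proof eventually_elim
    case (elim k)
    have "norm (u k) * norm (u k) = u k \<bullet> B (R (u k))"
      by (simp add: BR flip: power2_eq_square power2_norm_eq_inner)
    also have "\<dots> = R (u k) \<bullet> adjoint (A k) (u k) + u k \<bullet> (B - A k) (R (u k))"
      by (simp add: adjoint_works[OF lin] blinfun.diff_left inner_diff_right inner_commute)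
    also have "\<dots> \<le> norm (R (u k)) * norm (adjoint (A k) (u k)) +
        norm (u k) * norm ((B - A k) (R (u k)))"
      by (intro add_mono norm_cauchy_schwarz)
    also have "\<dots> \<le> (norm R * norm (u k)) * c +
        norm (u k) * (norm (B - A k) * (norm R * norm (u k)))"
      by (intro add_mono mult_mono norm_blinfun c order_trans[OF norm_blinfun] mult_left_mono) auto
    also have "\<dots> = (c * norm R + (norm (B - A k) * norm R) * norm (u k)) * norm (u k)"
      by (simp add: algebra_simps)
    also have "\<dots> \<le> (c * norm R + (1 / 2) * norm (u k)) * norm (u k)"
      by (intro mult_right_mono add_left_mono less_imp_le[OF elim]) auto
    finally have "u k = 0 \<or> norm (u k) \<le> c * norm R + (1 / 2) * norm (u k)"
      by (metis mult_right_le_imp_le norm_ge_zero norm_le_zero_iff not_less)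
    then show ?case
      using \<open>0 < c\<close> by auto
  qed
  then show ?thesis
    by (simp add: Bseq_eq_bounded[symmetric] BfunI)
qed

text \<open>Surjectivity holds near \<open>z0\<close>, so the formula for regular normals is
  available at all nearby points and only has to be passed to the limit: in one direction the
  multipliers are compact, in the other the local section lifts points of \<open>D\<close>.\<close>

lemma limiting_normal_cone_vimage:
  fixes F :: "'a::euclidean_space \<Rightarrow> 'b::euclidean_space"
  assumes derF: "\<And>z. (F has_derivative blinfun_apply (F' z)) (at z)"
    and contF: "continuous_on UNIV F'"
    and surj: "\<forall>\<^sub>F z in nhds z0. surj (blinfun_apply (F' z))"
  shows "limiting_normal_cone (F -` D) z0 = adjoint (F' z0) ` limiting_normal_cone D (F z0)"
proof (cases "F z0 \<in> D")
  case True
  have surj0: "surj (blinfun_apply (F' z0))"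
    using surj by (rule eventually_nhds_x_imp_x)
  have F'_lim: "(\<lambda>k. F' (z k)) \<longlonglongrightarrow> F' z0" if "z \<longlonglongrightarrow> z0" for z :: "nat \<Rightarrow> 'a"
    using contF that by (rule continuous_on_tendsto_compose) auto
  have F_lim: "(\<lambda>k. F (z k)) \<longlonglongrightarrow> F z0" if "z \<longlonglongrightarrow> z0" for z :: "nat \<Rightarrow> 'a"
    using isCont_tendsto_compose[OF has_derivative_continuous[OF derF] that] .
  have "outer_limit (regular_normal_cone (F -` D)) (F -` D) z0 =
      outer_limit (\<lambda>z. adjoint (F' z) ` regular_normal_cone D (F z)) (F -` D) z0"
    using surj by (intro outer_limit_cong_eventually)
      (auto elim!: eventually_mono simp: regular_normal_cone_vimage[OF derF contF])
  also have "\<dots> = adjoint (F' z0) ` outer_limit (regular_normal_cone D) D (F z0)"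
  proof (intro equalityI subsetI)
    fix v assume "v \<in> outer_limit (\<lambda>z. adjoint (F' z) ` regular_normal_cone D (F z)) (F -` D) z0"
    then obtain z v' where z: "\<And>k. F (z k) \<in> D"
      "\<And>k. v' k \<in> adjoint (F' (z k)) ` regular_normal_cone D (F (z k))" "z \<longlonglongrightarrow> z0" "v' \<longlonglongrightarrow> v"
      unfolding outer_limit_def by auto
    from z(2) obtain u where u: "\<And>k. v' k = adjoint (F' (z k)) (u k)"
      "\<And>k. u k \<in> regular_normal_cone D (F (z k))"
      unfolding image_iff by metis
    \<comment> \<open>The multipliers \<open>u k\<close> need not converge, but they are bounded, so
      a subsequence does, and its limit represents \<open>v\<close>.\<close>
    have "bounded (range u)"
      using F'_lim[OF z(3)] surj0
      by (rule bounded_adjoint_preimages)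
        (use z(4) in \<open>simp add: convergent_imp_bounded flip: u(1)\<close>)
    then obtain l s where s: "strict_mono s" "(u \<circ> s) \<longlonglongrightarrow> l"
      using bounded_imp_convergent_subsequence by blast
    have zs: "(\<lambda>k. z (s k)) \<longlonglongrightarrow> z0"
      using LIMSEQ_subseq_LIMSEQ[OF z(3) s(1)] by (simp add: o_def)
    have "(\<lambda>k. v' (s k)) \<longlonglongrightarrow> adjoint (F' z0) l"
      using adjoint_blinfun_tendsto[OF F'_lim[OF zs] s(2)] by (simp add: u(1))
    moreover have "(\<lambda>k. v' (s k)) \<longlonglongrightarrow> v"
      using LIMSEQ_subseq_LIMSEQ[OF z(4) s(1)] by (simp add: o_def)
    ultimately have "v = adjoint (F' z0) l"
      by (rule LIMSEQ_unique[symmetric])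
    moreover have "l \<in> outer_limit (regular_normal_cone D) D (F z0)"
      using z(1) u(2) by (intro outer_limitI_eventually[OF _ F_lim[OF zs] s(2)]) auto
    ultimately show "v \<in> adjoint (F' z0) ` outer_limit (regular_normal_cone D) D (F z0)"
      by blast
  next
    fix v assume "v \<in> adjoint (F' z0) ` outer_limit (regular_normal_cone D) D (F z0)"
    then obtain d u l where u: "\<And>k. d k \<in> D" "\<And>k. u k \<in> regular_normal_cone D (d k)"
      "d \<longlonglongrightarrow> F z0" "u \<longlonglongrightarrow> l" "v = adjoint (F' z0) l"
      unfolding outer_limit_def by auto
    obtain R where R: "linear R" "blinfun_apply (F' z0) \<circ> R = id"
      using linear_surjective_right_inverse surj0
        bounded_linear.linear[OF blinfun.bounded_linear_right] by blast
    obtain g where g: "g 0 = z0" "(g has_derivative (\<lambda>h. h)) (at 0)"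
      "\<forall>\<^sub>F p in nhds 0. F (g p) = F z0 + F' z0 p"
      using submersion_local_section[OF derF contF surj0] by blast
    have "(\<lambda>k. R (d k - F z0)) \<longlonglongrightarrow> R (F z0 - F z0)"
      using R(1) by (intro tendsto_intros u(3) bounded_linear.tendsto[of R])
        (simp add: linear_conv_bounded_linear)
    then have lim0: "(\<lambda>k. R (d k - F z0)) \<longlonglongrightarrow> 0"
      using R(1) by (simp add: linear_0)
    \<comment> \<open>Since \<open>R\<close> is a right inverse of \<open>F' z0\<close>, eventually
      \<open>F (z k) = d k\<close>; hence \<open>u k\<close> is a regular normal to \<open>D\<close>
      at \<open>F (z k)\<close>.\<close>
    define z where "z k = g (R (d k - F z0))" for k
    have z: "z \<longlonglongrightarrow> z0"
      using isCont_tendsto_compose[OF has_derivative_continuous[OF g(2)] lim0]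
      by (simp add: g(1) z_def[abs_def])
    have "\<forall>\<^sub>F k in sequentially. F (z k) = F z0 + F' z0 (R (d k - F z0))"
      unfolding z_def using g(3) lim0 by (rule eventually_compose_filterlim)
    then have "\<forall>\<^sub>F k in sequentially. z k \<in> F -` D \<and>
        adjoint (F' (z k)) (u k) \<in> adjoint (F' (z k)) ` regular_normal_cone D (F (z k))"
    proof eventually_elim
      case (elim k)
      then have "F (z k) = d k"
        using R(2) by (simp add: fun_eq_iff)
      then show ?case
        using u(1,2) by auto
    qed
    then show "v \<in> outer_limit (\<lambda>z. adjoint (F' z) ` regular_normal_cone D (F z)) (F -` D) z0"
      unfolding u(5) using z adjoint_blinfun_tendsto[OF F'_lim[OF z] u(4)]
      by (rule outer_limitI_eventually)
  qed
  finally show ?thesis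
    using True by (simp add: limiting_normal_cone_def)
\<comment> \<open>Off the preimage both cones are empty by definition.\<close>
qed (simp add: limiting_normal_cone_def)

section \<open>Projectional coderivative of the solution map\<close>

text \<open>Chain rule along the slice \<open>w' \<mapsto> (w', x)\<close>, followed by uniqueness
  of derivatives.\<close>

lemma jacobian_w_apply:
  assumes "(G has_derivative G') (at (w, x))"
  shows "jacobian_w G w x *v h = G' (h, 0)"
proof -
  have der: "((\<lambda>w'. G (w', x)) has_derivative (\<lambda>h. G' (h, 0))) (at w)"
    using has_derivative_compose[OF
        has_derivative_Pair[OF has_derivative_ident has_derivative_const] assms] .
  show ?thesis
    unfolding jacobian_w_def
    by (rule fun_cong[OF has_derivative_unique[OF
            jacobian_works[THEN iffD1, OF differentiableI[OF der]] der]])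
qed

lemma jacobian_x_apply:
  assumes "(G has_derivative G') (at (w, x))"
  shows "jacobian_x G w x *v h = G' (0, h)"
proof -
  have der: "((\<lambda>x'. G (w, x')) has_derivative (\<lambda>h. G' (0, h))) (at x)"
    using has_derivative_compose[OF
        has_derivative_Pair[OF has_derivative_const has_derivative_ident] assms] .
  show ?thesis
    unfolding jacobian_x_def
    by (rule fun_cong[OF has_derivative_unique[OF
            jacobian_works[THEN iffD1, OF differentiableI[OF der]] der]])
qed

text \<open>With partial Jacobians for \<open>A\<close> and \<open>B\<close>, the map is the
  derivative of \<open>(w, x) \<mapsto> (x, - G (w, x))\<close>. Its block rows are
  \<open>(0, I)\<close> and \<open>(- A, - B)\<close>, and the adjoint transposes the block
  matrix.\<close>

lemma adjoint_snd_minus_blocks: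
  fixes A :: "real^'m^'d" and B :: "real^'n^'d"
  shows "adjoint (\<lambda>h. (snd h, - (A *v fst h + B *v snd h))) =
    (\<lambda>z. (- (transpose A *v snd z), fst z - transpose B *v snd z))"
  by (rule adjoint_unique)
    (simp add: inner_prod_def inner_simps dot_lmul_matrix inner_commute[of _ "_ v* _"]
      inner_commute[of _ "_ *v _"])

text \<open>The first component prescribes \<open>snd h\<close>; surjectivity of \<open>A\<close>
  then lets the second be solved for \<open>fst h\<close>.\<close>

lemma surj_snd_minus_blocks:
  fixes A :: "real^'m^'d" and B :: "real^'n^'d"
  assumes "rank A = CARD('d)"
  shows "surj (\<lambda>h. (snd h, - (A *v fst h + B *v snd h)))"
proof -
  have A: "surj ((*v) A)"
    using assms by (simp add: full_rank_surjective)
  have "y = (\<lambda>h. (snd h, - (A *v fst h + B *v snd h)))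
      (inv ((*v) A) (- snd y - B *v fst y), fst y)" for y
    by (simp add: surj_f_inv_f[OF A])
  then show ?thesis
    by (rule surjI[OF sym])
qed

section \<open>Normals to the graph of \<open>S\<close> and the final formula\<close>

text \<open>A normal \<open>(a, b)\<close> to the graph of \<open>M\<close> at
  \<open>(x, - G (w, x))\<close> means \<open>a \<in> coderivative M x (- G (w, x)) (- b)\<close>,
  so \<open>y = - b\<close> turns its image under the adjoint derivative into the stated
  form.\<close>

lemma limiting_normal_cone_gph_solution_map:
  fixes G :: "(real^'m) \<times> (real^'n) \<Rightarrow> real^'d"
  assumes G: "continuously_differentiable G"
    and S: "\<And>w. S w = {x. 0 \<in> G (w, x) +o M x}"
    and rank: "\<forall>\<^sub>F (w', x') in nhds (w, x). rank (jacobian_w G w' x') = CARD('d)"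
  shows "(v, s) \<in> limiting_normal_cone (gph S) (w, x) \<longleftrightarrow>
    (\<exists>y. v = transpose (jacobian_w G w x) *v y \<and>
      s \<in> (transpose (jacobian_x G w x) *v y) +o coderivative M x (- G (w, x)) y)"
proof -
  obtain G' where derG: "\<And>z. (G has_derivative blinfun_apply (G' z)) (at z)"
    and contG: "continuous_on UNIV G'"
    using G unfolding continuously_differentiable_def by blast
  define F where "F z = (snd z, - G z)" for z
  \<comment> \<open>Writing \<open>F'\<close> through constant bounded operators \<open>P\<close>
    and \<open>Q\<close> makes its continuity follow from that of \<open>G'\<close>.\<close>
  define P :: "((real^'m) \<times> (real^'n)) \<Rightarrow>\<^sub>L ((real^'n) \<times> (real^'d))"
    where "P = Blinfun (\<lambda>h. (snd h, 0))"
  define Q :: "(real^'d) \<Rightarrow>\<^sub>L ((real^'n) \<times> (real^'d))" where "Q = Blinfun (\<lambda>y. (0, - y))"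
  define F' where "F' z = P + (Q o\<^sub>L G' z)" for z
  have P: "P h = (snd h, 0)" and Q: "Q y = (0, - y)" for h y
    unfolding P_def Q_def
    by (auto intro!: bounded_linear_Blinfun_apply[THEN fun_cong] bounded_linear_intros
        bounded_linear_minus[OF bounded_linear_ident])
  have F'_apply: "F' z h = (snd h, - G' z h)" for z h
    by (simp add: F'_def blinfun.add_left P Q)
  have F'_blocks: "blinfun_apply (F' (w, x)) =
      (\<lambda>h. (snd h, - (jacobian_w G w x *v fst h + jacobian_x G w x *v snd h)))" for w x
    by (simp add: fun_eq_iff F'_apply jacobian_w_apply[OF derG] jacobian_x_apply[OF derG]
        flip: blinfun.add_right)
  have derF: "(F has_derivative blinfun_apply (F' z)) (at z)" for z
    unfolding F_def[abs_def]
    by (rule has_derivative_eq_rhs, (rule derivative_intros derG)+) (simp add: F'_apply fun_eq_iff)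
  have contF: "continuous_on UNIV F'"
    unfolding F'_def by (intro continuous_intros contG)
  have surj: "\<forall>\<^sub>F z in nhds (w, x). surj (blinfun_apply (F' z))"
    using rank
    by (rule eventually_mono) (elim case_prodE, simp only: F'_blocks surj_snd_minus_blocks)
  have "0 \<in> y +o Y \<longleftrightarrow> - y \<in> Y" for y :: "real^'d" and Y
    by (auto simp: elt_set_plus_def minus_unique intro: bexI[of _ "- y"])
  then have gphS: "gph S = F -` gph M"
    by (auto simp: gph_def F_def S)
  have neg: "C *v - y = - (C *v y)" for C :: "real^'d^'k" and y
    by (rule linear_neg[OF matrix_vector_mul_linear])
  have "(v, s) \<in> limiting_normal_cone (gph S) (w, x) \<longleftrightarrow>
      (\<exists>b a. a \<in> coderivative M x (- G (w, x)) (- b) \<and>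
        v = - (transpose (jacobian_w G w x) *v b) \<and>
        s = a - transpose (jacobian_x G w x) *v b)"
    unfolding gphS limiting_normal_cone_vimage[OF derF contF surj] F'_blocks
      adjoint_snd_minus_blocks coderivative_def image_iff Bex_def split_paired_Ex F_def
      mem_Collect_eq minus_minus fst_conv snd_conv prod.inject
    by blast
  \<comment> \<open>Substitute \<open>b = - y\<close>, which ranges over the same space.\<close>
  also have "\<dots> \<longleftrightarrow> (\<exists>y a. a \<in> coderivative M x (- G (w, x)) (- (- y)) \<and>
        v = - (transpose (jacobian_w G w x) *v - y) \<and>
        s = a - transpose (jacobian_x G w x) *v - y)"
    by (metis minus_minus)
  finally show ?thesis
    unfolding neg elt_set_plus_def mem_Collect_eq Bex_def minus_minus diff_minus_eq_add
    by (metis add.commute)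
qed

theorem theorem3p7:
  fixes G :: "(real^'m) \<times> (real^'n) \<Rightarrow> real^'d"
    and M :: "real^'n \<Rightarrow> (real^'d) set"
    and S :: "real^'m \<Rightarrow> (real^'n) set"
    and wbar :: "real^'m" and xbar r :: "real^'n"
  assumes "continuously_differentiable G"
    and "closed (gph M)"
    and S: "\<And>w. S w = {x. 0 \<in> G (w, x) +o M x}"
    and "(wbar, xbar) \<in> gph S"
    and "\<forall>\<^sub>F (w, x) in nhds (wbar, xbar). rank (jacobian_w G w x) = CARD('d)"
  shows "projectional_coderivative (mdom S) S wbar xbar r =
    outer_limit
      (\<lambda>((w, x), r'). \<Union>y\<in>{y. - r' \<in> (transpose (jacobian_x G w x) *v y)
                                     +o coderivative M x (- G (w, x)) y}.
         proj (contingent_cone (mdom S) w) (transpose (jacobian_w G w x) *v y))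
      (gph S \<times> UNIV) ((wbar, xbar), r)"
proof -
  \<comment> \<open>\<open>S\<close> is empty off \<open>mdom S\<close>, so the restriction changes
    nothing.\<close>
  have restrict: "mrestrict S (mdom S) = S"
    by (auto simp: mrestrict_def mdom_def fun_eq_iff)
  \<comment> \<open>The normal cone formula at a point needs full rank on a neighbourhood of that
    point, and all points near the reference point have such a neighbourhood.\<close>
  have "\<forall>\<^sub>F z in nhds (wbar, xbar). \<forall>\<^sub>F (w, x) in nhds z. rank (jacobian_w G w x) = CARD('d)"
    using assms(5) by (simp only: eventually_eventually)
  then have "\<forall>\<^sub>F p in nhds ((wbar, xbar), r).
      \<forall>\<^sub>F (w, x) in nhds (fst p). rank (jacobian_w G w x) = CARD('d)"
    using filterlim_fst[of "nhds (wbar, xbar)"]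
    unfolding nhds_prod by (rule eventually_compose_filterlim)
  \<comment> \<open>After slicing, both sides are outer limits over the same set, so it suffices to
    compare their values near the reference point.\<close>
  then show ?thesis
    unfolding projectional_coderivative_def restrict outer_limit_slice
  proof (intro outer_limit_cong_eventually, elim eventually_mono, intro impI)
    fix p :: "((real^'m) \<times> (real^'n)) \<times> (real^'n)"
    assume *: "\<forall>\<^sub>F (w, x) in nhds (fst p). rank (jacobian_w G w x) = CARD('d)"
    obtain w x r' where p: "p = ((w, x), r')"
      by (metis surj_pair)
    note N = limiting_normal_cone_gph_solution_map[OF assms(1) S *[unfolded p fst_conv]]
    \<comment> \<open>The projection keeps the second component, so exactly the normals
      \<open>(v, - r')\<close> contribute, and \<open>t\<close> is a projection of
      \<open>v\<close>.\<close>
    have "(t, - r') \<in> proj_set (contingent_cone (mdom S) w \<times> UNIV)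
          (limiting_normal_cone (gph S) (w, x)) \<longleftrightarrow>
        (\<exists>v. (v, - r') \<in> limiting_normal_cone (gph S) (w, x) \<and>
          t \<in> proj (contingent_cone (mdom S) w) v)" for t
      unfolding proj_set_def by (auto simp: proj_Times_UNIV Bex_def)
    then show "(\<lambda>(z, r'). {t. (t, - r') \<in> (case z of (w, x) \<Rightarrow>
          proj_set (contingent_cone (mdom S) w \<times> UNIV) (limiting_normal_cone (gph S) (w, x)))}) p =
        (\<lambda>((w, x), r').
          \<Union>y\<in>{y. - r' \<in> (transpose (jacobian_x G w x) *v y)
                         +o coderivative M x (- G (w, x)) y}.
            proj (contingent_cone (mdom S) w) (transpose (jacobian_w G w x) *v y)) p"
      unfolding p prod.case N by blast
  qed
qed

end
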